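(* Let $r<p$ be positive integers, let $A\in\mathbb{R}^{p\times r}$ satisfy $A^TA=I_r$, and let $\theta\in(0,1)$ with $\theta\le 1/6$. Consider the optimization problem $$\min_{q\in\mathbb{R}^p}\ f(q)=-\tfrac14\Big[(1-\theta)\|A^Tq\|_4^4+\theta\|A^Tq\|_2^4\Big]\quad\text{subject to }\|q\|_2=1.$$ Let $R_0=\{q\in\mathbb{S}^{p-1}:\|A^Tq\|_\infty=0\}$. Then any local solution $\bar q$ of this problem with $\bar q\notin R_0$ satisfies $\bar q=AP_{\cdot1}$ for some signed permutation matrix $P\in\mathbb{R}^{r\times r}$, where $P_{\cdot 1}$ is the first column of $P$ (i.e. $\bar q$ equals a column of $A$ up to sign).
   Context: $\mathbb{S}^{p-1}$ is the unit sphere of $\mathbb{R}^p$. $\|\cdot\|_m$ denotes the $\ell_m$ norm of a vector. A local solution is a local minimizer of $f$ restricted to $\mathbb{S}^{p-1}$. A signed permutation matrix is a permutation matrix whose nonzero entries may be $+1$ or $-1$. *)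

theory Defs
  imports "HOL-Analysis.Analysis"
begin

(* Only meaningful for m > 0; the l_2 and l_infinity norms are the library's norm and infnorm. *)
definition lp_norm :: "nat \<Rightarrow> real ^ 'n \<Rightarrow> real" where
  "lp_norm m x = root m (\<Sum>i\<in>UNIV. \<bar>x $ i\<bar> ^ m)"

definition objective :: "real \<Rightarrow> real ^ 'r ^ 'p \<Rightarrow> real ^ 'p \<Rightarrow> real" where
  "objective \<theta> A q =
     - (1 / 4) * ((1 - \<theta>) * lp_norm 4 (transpose A *v q) ^ 4
                  + \<theta> * norm (transpose A *v q) ^ 4)"

definition local_minimizer_on ::
    "('a::topological_space \<Rightarrow> real) \<Rightarrow> 'a set \<Rightarrow> 'a \<Rightarrow> bool" where
  "local_minimizer_on f S x \<longleftrightarrow> x \<in> S \<and> (\<forall>\<^sub>F y in at x within S. f x \<le> f y)"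

definition R0 :: "real ^ 'r ^ 'p \<Rightarrow> (real ^ 'p) set" where
  "R0 A = {q \<in> sphere 0 1. infnorm (transpose A *v q) = 0}"

definition signed_permutation_matrix :: "real ^ 'r ^ 'r \<Rightarrow> bool" where
  "signed_permutation_matrix P \<longleftrightarrow>
     (\<exists>\<pi>. \<pi> permutes UNIV \<and>
          (\<forall>i j. if i = \<pi> j then P $ i $ j \<in> {1, -1} else P $ i $ j = 0))"

end

theory Submission
  imports Defs
begin

text \<open>
  In terms of the squares \<open>X k = w k ^ 2\<close> of the coordinates of \<open>w = A\<^sup>T q\<close>, the objective is
  \<open>-(1/4) ((1 - \<theta>) (\<Sum>k. (X k)\<^sup>2) + \<theta> (\<Sum>k. X k)\<^sup>2)\<close>, which is strictly concave and decreasing in the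
  nonnegative vector \<open>X\<close>.  The attainable \<open>X\<close> form a simplex with vertices \<open>0\<close> and the
  standard basis vectors, so by concavity one expects local minimizers only at vertices, and
  the vertex \<open>0\<close> is exactly \<open>R0 A\<close>.

  To make this concrete, let \<open>i\<close> be a coordinate at which \<open>X\<close> is maximal; it is positive because
  \<open>q\<close> is not in \<open>R0 A\<close>.  Split \<open>q = x + y\<close> with \<open>x\<close> the projection of \<open>q\<close> on the column
  \<open>A e\<^sub>i\<close>.  If \<open>y\<close> were nonzero, one could shrink \<open>y\<close> slightly and stretch \<open>x\<close> so as to stay on
  the sphere (\<open>local_minimizer_on_sphere_rescale\<close>).  This multiplies every \<open>X k\<close> with
  \<open>k \<noteq> i\<close> by a factor below \<open>1\<close>, while \<open>X i\<close> grows by the whole mass that \<open>y\<close> loses,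
  which by Bessel's inequality is at least what the other coordinates lose.  Such a transfer
  towards the largest coordinate strictly lowers the objective
  (\<open>objective_less_by_transfer\<close>), contradicting local minimality.  Hence \<open>y = 0\<close>
  and \<open>q = \<plusminus> A e\<^sub>i\<close>.
\<close>

text \<open>
  Local minimality is used only along one curve on the sphere, on which a fraction \<open>e\<close> of
  the squared length of \<open>y\<close> is handed over to \<open>x\<close>, for \<open>e\<close> decreasing to \<open>0\<close>.
\<close>
lemma local_minimizer_on_sphere_rescale:
  fixes x y :: "'a::real_inner"
  assumes lm: "local_minimizer_on f (sphere 0 1) (x + y)"
    and "x \<bullet> y = 0" and "x \<noteq> 0"
  obtains \<mu> \<nu> :: real where "\<nu>\<^sup>2 < 1" and "\<mu>\<^sup>2 * (norm x)\<^sup>2 + \<nu>\<^sup>2 * (norm y)\<^sup>2 = 1"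
    and "f (x + y) \<le> f (\<mu> *\<^sub>R x + \<nu> *\<^sub>R y)"
proof -
  define m where "m e = sqrt (1 + e * ((norm y)\<^sup>2 / (norm x)\<^sup>2))" for e
  define n where "n e = sqrt (1 - e)" for e :: real
  define c where "c e = m e *\<^sub>R x + n e *\<^sub>R y" for e
  have pyth: "(norm (s *\<^sub>R x + t *\<^sub>R y))\<^sup>2 = s\<^sup>2 * (norm x)\<^sup>2 + t\<^sup>2 * (norm y)\<^sup>2" for s t
    using \<open>x \<bullet> y = 0\<close> unfolding power2_norm_eq_inner
    by (simp add: inner_add_left inner_add_right inner_commute[of y x] power2_eq_square)
  have "norm (x + y) = 1"
    using lm by (simp add: local_minimizer_on_def)
  then have unit: "(norm x)\<^sup>2 + (norm y)\<^sup>2 = 1"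
    using pyth[of 1 1] by simp
  have mass: "(m e)\<^sup>2 * (norm x)\<^sup>2 + (n e)\<^sup>2 * (norm y)\<^sup>2 = 1" if "0 < e" "e < 1" for e
  proof -
    have "(m e)\<^sup>2 = 1 + e * ((norm y)\<^sup>2 / (norm x)\<^sup>2)" "(n e)\<^sup>2 = 1 - e"
      using that by (simp_all add: m_def n_def)
    then have "(m e)\<^sup>2 * (norm x)\<^sup>2 = (norm x)\<^sup>2 + e * (norm y)\<^sup>2"
      and "(n e)\<^sup>2 * (norm y)\<^sup>2 = (norm y)\<^sup>2 - e * (norm y)\<^sup>2"
      using \<open>x \<noteq> 0\<close> by (simp_all add: distrib_right left_diff_distrib)
    then show ?thesis
      using unit by simp
  qed
  have near: "\<forall>\<^sub>F e in at_right (0::real). 0 < e \<and> e < 1"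
    using eventually_at_right_real[of "0::real" 1] by simp
  have "isCont c 0"
    unfolding c_def m_def n_def by (intro continuous_intros)
  then have "c \<midarrow>0\<rightarrow> x + y"
    by (simp add: isCont_def c_def m_def n_def)
  then have lim: "(c \<longlongrightarrow> x + y) (at_right 0)"
    by (rule filterlim_at_split[THEN iffD1, THEN conjunct2])
  have "\<forall>\<^sub>F e in at_right 0. c e \<in> sphere 0 1"
    using near
  proof eventually_elim
    case (elim e)
    then have "(norm (c e))\<^sup>2 = 1"
      unfolding c_def pyth by (intro mass) auto
    then show ?case
      by (simp add: power2_eq_1_iff) (smt (verit) norm_ge_zero)
  qed
  moreover have "\<forall>\<^sub>F z in nhds (x + y). z \<in> sphere 0 1 \<longrightarrow> f (x + y) \<le> f z"
    using lm unfolding local_minimizer_on_def eventually_at_filter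
    by (auto elim: eventually_mono)
  then have "\<forall>\<^sub>F e in at_right 0. c e \<in> sphere 0 1 \<longrightarrow> f (x + y) \<le> f (c e)"
    using lim by (auto simp: filterlim_iff)
  ultimately have "\<forall>\<^sub>F e in at_right 0. (0 < e \<and> e < 1) \<and> f (x + y) \<le> f (c e)"
    using near by eventually_elim auto
  then obtain e where e: "0 < e" "e < 1" "f (x + y) \<le> f (c e)"
    using eventually_happens'[OF trivial_limit_at_right_real] by blast
  show ?thesis
  proof (rule that)
    show "(n e)\<^sup>2 < 1" using e by (simp add: n_def)
    show "(m e)\<^sup>2 * (norm x)\<^sup>2 + (n e)\<^sup>2 * (norm y)\<^sup>2 = 1" using e by (intro mass)
    show "f (x + y) \<le> f (m e *\<^sub>R x + n e *\<^sub>R y)" using e by (simp add: c_def)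
  qed
qed

lemma objective_eq_squares:
  "objective \<theta> A q = - (1 / 4) * ((1 - \<theta>) * (\<Sum>k\<in>UNIV. (((transpose A *v q) $ k)\<^sup>2)\<^sup>2)
     + \<theta> * (\<Sum>k\<in>UNIV. ((transpose A *v q) $ k)\<^sup>2)\<^sup>2)"
proof -
  define w where "w = transpose A *v q"
  have "lp_norm 4 w ^ 4 = (\<Sum>k\<in>UNIV. ((w $ k)\<^sup>2)\<^sup>2)"
    by (simp add: lp_norm_def sum_nonneg)
  moreover have "norm w ^ 4 = ((norm w)\<^sup>2)\<^sup>2"
    by simp
  then have "norm w ^ 4 = (\<Sum>k\<in>UNIV. (w $ k)\<^sup>2)\<^sup>2"
    unfolding power2_norm_eq_inner by (simp add: inner_vec_def power2_eq_square)
  ultimately show ?thesis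
    unfolding objective_def w_def by presburger
qed

text \<open>
  Write \<open>Y = X + d\<close>.  Then \<open>\<Sum>Y\<^sup>2 - \<Sum>X\<^sup>2 = 2 \<Sum>X d + \<Sum>d\<^sup>2\<close>, and since \<open>d\<close> is nonpositive wherever
  \<open>X\<close> may be below its maximum \<open>X i\<close>, the linear term is at least \<open>2 X i \<Sum>d \<ge> 0\<close>.
\<close>
lemma sum_squares_less_by_transfer:
  fixes X Y :: "'k \<Rightarrow> real"
  assumes "finite K" and "i \<in> K" and "0 \<le> X i"
    and max: "\<And>k. k \<in> K \<Longrightarrow> X k \<le> X i"
    and gain: "X i < Y i" and loss: "\<And>k. k \<in> K \<Longrightarrow> k \<noteq> i \<Longrightarrow> Y k \<le> X k"
    and total: "sum X K \<le> sum Y K"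
  shows "(\<Sum>k\<in>K. (X k)\<^sup>2) < (\<Sum>k\<in>K. (Y k)\<^sup>2)"
proof -
  define d where "d k = Y k - X k" for k
  have "0 \<le> X i * sum d K"
    using total \<open>0 \<le> X i\<close> by (simp add: d_def sum_subtractf)
  also have "\<dots> \<le> (\<Sum>k\<in>K. X k * d k)"
    unfolding sum_distrib_left
  proof (rule sum_mono)
    fix k assume "k \<in> K"
    then show "X i * d k \<le> X k * d k"
      using max[of k] loss[of k] by (cases "k = i") (auto simp: d_def intro: mult_right_mono_neg)
  qed
  finally have linear: "0 \<le> (\<Sum>k\<in>K. X k * d k)" .
  have "0 < (\<Sum>k\<in>K. (d k)\<^sup>2)"
    using assms by (intro sum_pos2[of K i]) (auto simp: d_def)
  moreover have "(Y k)\<^sup>2 = (X k)\<^sup>2 + 2 * (X k * d k) + (d k)\<^sup>2" for k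
    by (simp add: d_def power2_eq_square algebra_simps)
  then have "(\<Sum>k\<in>K. (Y k)\<^sup>2) = (\<Sum>k\<in>K. (X k)\<^sup>2) + 2 * (\<Sum>k\<in>K. X k * d k) + (\<Sum>k\<in>K. (d k)\<^sup>2)"
    by (simp add: sum.distrib sum_distrib_left)
  ultimately show ?thesis
    using linear by linarith
qed

lemma objective_less_by_transfer:
  fixes A :: "real ^ 'r ^ 'p"
  defines "X \<equiv> \<lambda>z k. ((transpose A *v z) $ k)\<^sup>2"
  assumes "0 \<le> \<theta>" and "\<theta> < 1"
    and "\<And>k. X q k \<le> X q i"
    and "X q i < X z i" and "\<And>k. k \<noteq> i \<Longrightarrow> X z k \<le> X q k"
    and total: "sum (X q) UNIV \<le> sum (X z) UNIV"
  shows "objective \<theta> A z < objective \<theta> A q"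
proof -
  have "(\<Sum>k\<in>UNIV. (X q k)\<^sup>2) < (\<Sum>k\<in>UNIV. (X z k)\<^sup>2)"
    using assms by (intro sum_squares_less_by_transfer[of UNIV i]) (auto simp: X_def)
  then have "(1 - \<theta>) * (\<Sum>k\<in>UNIV. (X q k)\<^sup>2) < (1 - \<theta>) * (\<Sum>k\<in>UNIV. (X z k)\<^sup>2)"
    using \<open>\<theta> < 1\<close> by simp
  moreover have "\<theta> * (sum (X q) UNIV)\<^sup>2 \<le> \<theta> * (sum (X z) UNIV)\<^sup>2"
    using total \<open>0 \<le> \<theta>\<close> by (intro mult_left_mono power_mono) (auto simp: X_def intro: sum_nonneg)
  ultimately show ?thesis
    unfolding objective_eq_squares X_def by (simp add: algebra_simps)
qed

text \<open>
  The component of \<open>q\<close> orthogonal to the dominant column contains both its components along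
  the other columns and the part outside the column space of \<open>A\<close>.  Shrinking it as a whole
  therefore rules out both kinds of deviation with a single curve.
\<close>
lemma local_minimizer_objective_signed_column:
  fixes A :: "real ^ 'r ^ 'p"
  assumes orth: "transpose A ** A = mat 1"
    and "0 \<le> \<theta>" and "\<theta> < 1"
    and lm: "local_minimizer_on (objective \<theta> A) (sphere 0 1) q"
    and "transpose A *v q \<noteq> 0"
  shows "\<exists>i s. s \<in> {1, -1} \<and> q = A *v axis i s"
proof -
  \<comment> \<open>This simp rule would turn \<open>transpose A *v q\<close> into \<open>q v* A\<close> and hide \<open>w\<close>.\<close>
  note transpose_matrix_vector [simp del]
  define w where "w = transpose A *v q"
  have adj: "(A *v u) \<bullet> z = u \<bullet> (transpose A *v z)" for u z
    by (metis dot_lmul_matrix inner_commute transpose_matrix_vector transpose_transpose)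
  have inv: "transpose A *v (A *v u) = u" for u
    by (simp add: matrix_vector_mul_assoc orth)
  have iso: "norm (A *v u) = norm u" for u
    unfolding norm_eq_sqrt_inner adj inv ..
  have "norm q = 1"
    using lm by (simp add: local_minimizer_on_def)
  \<comment> \<open>Bessel's inequality, from \<open>w \<bullet> w = A w \<bullet> q\<close> and Cauchy-Schwarz.\<close>
  have "w \<bullet> w \<le> norm w"
    using norm_cauchy_schwarz[of "A *v w" q] \<open>norm q = 1\<close> by (simp add: adj iso w_def)
  then have "norm w * norm w \<le> norm w * 1"
    by (simp add: dot_square_norm power2_eq_square)
  then have "norm w \<le> 1"
    using \<open>transpose A *v q \<noteq> 0\<close> by (simp add: w_def)
  then have bessel: "(\<Sum>k\<in>UNIV. (w $ k)\<^sup>2) \<le> 1"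
    by (simp add: norm_vec_def L2_set_def sum_nonneg)
  obtain i where i: "\<And>k. (w $ k)\<^sup>2 \<le> (w $ i)\<^sup>2"
  proof -
    have "(MAX k. (w $ k)\<^sup>2) \<in> range (\<lambda>k. (w $ k)\<^sup>2)"
      by (intro Max_in) auto
    then obtain i where "(MAX k. (w $ k)\<^sup>2) = (w $ i)\<^sup>2"
      by blast
    then show ?thesis
      using that[of i] by (metis Max_ge finite finite_imageI rangeI)
  qed
  have wi: "w $ i \<noteq> 0"
  proof
    assume "w $ i = 0"
    then have "w $ k = 0" for k using i[of k] by simp
    then show False using \<open>transpose A *v q \<noteq> 0\<close> by (simp add: w_def vec_eq_iff)
  qed
  define x where "x = A *v axis i (w $ i)"
  define y where "y = q - x"
  have q: "x + y = q" by (simp add: y_def)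
  have norm_x: "(norm x)\<^sup>2 = (w $ i)\<^sup>2"
    unfolding x_def iso power2_norm_eq_inner by (simp add: inner_axis_axis power2_eq_square)
  have "x \<bullet> q = (w $ i)\<^sup>2"
    by (simp add: x_def adj w_def[symmetric] inner_axis' power2_eq_square)
  then have ortho: "x \<bullet> y = 0"
    by (simp add: y_def inner_diff_right dot_square_norm norm_x)
  have "(norm q)\<^sup>2 = (norm x)\<^sup>2 + (norm y)\<^sup>2"
    unfolding q[symmetric] power2_norm_eq_inner using ortho
    by (simp add: inner_add_left inner_add_right inner_commute[of y x])
  then have unit: "(w $ i)\<^sup>2 + (norm y)\<^sup>2 = 1"
    using \<open>norm q = 1\<close> norm_x by simp
  have "y = 0"
  proof (rule ccontr)
    assume "y \<noteq> 0"
    have "x \<noteq> 0" using norm_x wi by auto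
    then obtain \<mu> \<nu> :: real where \<nu>: "\<nu>\<^sup>2 < 1"
      and "\<mu>\<^sup>2 * (norm x)\<^sup>2 + \<nu>\<^sup>2 * (norm y)\<^sup>2 = 1"
      and le: "objective \<theta> A q \<le> objective \<theta> A (\<mu> *\<^sub>R x + \<nu> *\<^sub>R y)"
      using local_minimizer_on_sphere_rescale[of "objective \<theta> A" x y] lm ortho q by metis
    then have sphere: "\<mu>\<^sup>2 * (w $ i)\<^sup>2 + \<nu>\<^sup>2 * (norm y)\<^sup>2 = 1"
      by (simp add: norm_x)
    define z where "z = \<mu> *\<^sub>R x + \<nu> *\<^sub>R y"
    have "transpose A *v x = axis i (w $ i)"
      by (simp add: x_def inv)
    then have w_z: "(transpose A *v z) $ k = (if k = i then \<mu> * w $ i else \<nu> * w $ k)" for k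
      by (simp add: z_def y_def matrix_vector_right_distrib matrix_vector_mult_diff_distrib
          matrix_vector_mult_scaleR axis_def w_def[symmetric])
    have "objective \<theta> A z < objective \<theta> A q"
    proof (rule objective_less_by_transfer[of _ _ _ i])
      have "\<nu>\<^sup>2 * (norm y)\<^sup>2 < (norm y)\<^sup>2"
        using \<nu> \<open>y \<noteq> 0\<close> by simp
      then show "((transpose A *v q) $ i)\<^sup>2 < ((transpose A *v z) $ i)\<^sup>2"
        using sphere unit by (simp add: w_z w_def[symmetric] power_mult_distrib)
      show "((transpose A *v z) $ k)\<^sup>2 \<le> ((transpose A *v q) $ k)\<^sup>2" if "k \<noteq> i" for k
        using that \<nu> mult_right_mono[of "\<nu>\<^sup>2" 1 "(w $ k)\<^sup>2"]
        by (simp add: w_z w_def[symmetric] power_mult_distrib)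
      define S where "S = (\<Sum>k\<in>UNIV - {i}. (w $ k)\<^sup>2)"
      have S: "(\<Sum>k\<in>UNIV. (w $ k)\<^sup>2) = (w $ i)\<^sup>2 + S"
        by (simp add: S_def sum.remove[of _ i])
      have "(\<Sum>k\<in>UNIV. ((transpose A *v z) $ k)\<^sup>2) = \<mu>\<^sup>2 * (w $ i)\<^sup>2 + \<nu>\<^sup>2 * S"
        by (simp add: S_def sum.remove[of _ i] w_z power_mult_distrib sum_distrib_left)
      moreover have "(1 - \<nu>\<^sup>2) * S \<le> (1 - \<nu>\<^sup>2) * (norm y)\<^sup>2"
        using \<nu> bessel S unit by (intro mult_left_mono) auto
      ultimately show "(\<Sum>k\<in>UNIV. ((transpose A *v q) $ k)\<^sup>2)
          \<le> (\<Sum>k\<in>UNIV. ((transpose A *v z) $ k)\<^sup>2)"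
        using S sphere unit by (simp add: w_def[symmetric] algebra_simps)
    qed (use assms i in \<open>auto simp: w_def\<close>)
    then show False
      using le by (simp add: z_def)
  qed
  then have "q = A *v axis i (w $ i)" and "w $ i \<in> {1, -1}"
    using q unit by (auto simp: x_def power2_eq_1_iff)
  then show ?thesis by blast
qed

lemma signed_permutation_matrix_with_column:
  fixes i j :: "'r::finite"
  assumes "s \<in> {1, -1}"
  shows "\<exists>P :: real ^ 'r ^ 'r. signed_permutation_matrix P \<and> column j P = axis i s"
proof (intro exI conjI)
  define \<pi> where "\<pi> = Transposition.transpose i j"
  let ?P = "(\<chi> k l. if k = \<pi> l then s else 0) :: real ^ 'r ^ 'r"
  have "\<pi> permutes UNIV"
    unfolding \<pi>_def by (intro permutes_swap_id) auto
  then show "signed_permutation_matrix ?P"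
    unfolding signed_permutation_matrix_def using assms by (intro exI[of _ \<pi>]) auto
  show "column j ?P = axis i s"
    by (simp add: column_def axis_def vec_eq_iff \<pi>_def)
qed

(* A finite index type has no distinguished first element: j1 is whichever index is
   labelled 1, and the claim is made for every choice of it. *)
theorem mainTheorem1:
  fixes A :: "real ^ 'r ^ 'p" and \<theta> :: real and q :: "real ^ 'p" and j1 :: 'r
  assumes "CARD('r) < CARD('p)"
    and "transpose A ** A = mat 1"
    and "0 < \<theta>" and "\<theta> < 1" and "\<theta> \<le> 1 / 6"
    and "local_minimizer_on (objective \<theta> A) (sphere 0 1) q"
    and "q \<notin> R0 A"
  shows "\<exists>P :: real ^ 'r ^ 'r. signed_permutation_matrix P \<and> q = A *v column j1 P"
proof -
  have "q \<in> sphere 0 1"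
    using assms(6) by (simp add: local_minimizer_on_def)
  then have "transpose A *v q \<noteq> 0"
    using \<open>q \<notin> R0 A\<close> by (simp add: R0_def infnorm_eq_0)
  then obtain i s where "s \<in> {1, -1}" "q = A *v axis i s"
    using local_minimizer_objective_signed_column[of A \<theta> q] assms by auto
  then show ?thesis
    using signed_permutation_matrix_with_column[of s j1 i] by metis
qed

end
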